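(* Let $d\ge1$ and let $\mathcal{X}$ be a discrete subset of $\mathbb{R}^d$ with separation radius $\delta>0$, i.e. $$\delta=\frac12\inf_{\substack{x\neq y\\ x,y\in\mathcal{X}}}|x-y|.$$ Let $j\ge1$ be an integer and let $\mathcal{A}_{\delta,j}=\{y\in\mathbb{R}^d: j\delta\le|y-x_0|\le(j+1)\delta\}$ be an annulus (with arbitrary center $x_0\in\mathbb{R}^d$) of thickness $\delta$ and inner radius $j\delta$. Then $$|\mathcal{X}\cap\mathcal{A}_{\delta,j}|\ \le\ 2d\,j^{d-1}\,e^{\frac{5d-3}{4j-1}}.$$
   Context: $|x-y|$ is Euclidean distance in $\mathbb{R}^d$ and $|E|$ denotes the cardinality of a set $E$. *)

theory Defs
  imports "HOL-Analysis.Analysis"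
begin

text \<open>
  The infimum is taken in the extended reals, so that a set with at most one point has
  separation radius \<open>\<infinity>\<close> (infimum over the empty set) instead of an unspecified real number.
\<close>
definition separation_radius :: "'a::metric_space set \<Rightarrow> ereal" where
  "separation_radius X =
     (1 / 2) * (INF (x, y) \<in> {(x, y). x \<in> X \<and> y \<in> X \<and> x \<noteq> y}. ereal (dist x y))"

definition annulus :: "'a::metric_space \<Rightarrow> real \<Rightarrow> nat \<Rightarrow> 'a set" where
  "annulus x0 \<delta> j = {y. real j * \<delta> \<le> dist y x0 \<and> dist y x0 \<le> (real j + 1) * \<delta>}"

end

theory Submission
  imports Defs
begin

text \<open>
  The balls of radius \<open>\<delta>\<close> around the points of \<open>X\<close> are disjoint, and each one centred in the annulus
  has at least half of its volume in the slightly larger annulus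
  \<open>j \<delta> \<le> |y - x0| \<le> R \<delta>\<close> with \<open>R\<^sup>2 = (j + 1)\<^sup>2 + 1\<close>. Indeed the outward half ball, minus a cap
  that may stick out of this annulus, lies in it, and a point reflection carries the cap
  into the part of the annulus inside the inward half ball. Comparing volumes bounds the number of
  points by \<open>2 (R\<^sup>d - j\<^sup>d) \<le> 2 d R\<^bsup>d-1\<^esup> (R - j)\<close>.
\<close>

section \<open>Volumes of balls meeting an annulus\<close>

lemma measure_lebesgue_point_reflection:
  fixes S :: "'a::euclidean_space set"
  shows "measure lebesgue ((\<lambda>x. c - x) ` S) = measure lebesgue S"
  using measure_lebesgue_affine[of "-1" c S] by (simp cong: image_cong_simp)

text \<open>A point reflection is an involution, so the image of \<open>S\<close> is also its
  preimage under the same continuous map, and Borel measurability transfers.\<close>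

lemma lmeasurable_point_reflection:
  fixes S :: "'a::euclidean_space set"
  assumes "S \<in> sets borel" "bounded S"
  shows "(\<lambda>x. c - x) ` S \<in> lmeasurable"
proof (rule bounded_set_imp_lmeasurable)
  show "bounded ((\<lambda>x. c - x) ` S)"
    by (rule bounded_minus_comp) (use assms(2) in \<open>auto intro: bounded_subset[of "{c}"]\<close>)
  have "(\<lambda>x. c - x) ` S = (\<lambda>x. c - x) -` S"
    by (force simp: image_iff)
  moreover have "(\<lambda>x. c - x) \<in> borel_measurable borel"
    by measurable
  ultimately show "(\<lambda>x. c - x) ` S \<in> sets lebesgue"
    using measurable_sets_borel assms(1) by (metis sets_completionI_sets sets_lborel)
qed

text \<open>Within the ball, the slab \<open>a - r \<le> h y \<le> w\<close> lies in the annulus. It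
  contains \<open>H1\<close>, the lower part of the outward half ball, and also the reflected copy
  \<open>T\<close> of the remaining cap \<open>H2\<close>. As \<open>H1\<close> and \<open>T\<close>
  are disjoint, the slab has at least the volume of a half ball.\<close>

lemma half_ball_in_annulus:
  fixes x0 u :: "'a::euclidean_space"
  assumes u: "norm u = 1" and \<delta>: "\<delta> > 0" and a: "0 \<le> a"
    and r: "a \<le> r" "r \<le> a + \<delta>" and b: "0 \<le> b" "(a + \<delta>)\<^sup>2 + \<delta>\<^sup>2 \<le> b\<^sup>2"
  shows "measure lebesgue (ball (x0 + r *\<^sub>R u) \<delta>)
    \<le> 2 * measure lebesgue (ball (x0 + r *\<^sub>R u) \<delta> \<inter> (cball x0 b - ball x0 a))"
proof -
  define p where "p = x0 + r *\<^sub>R u"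
  \<comment> \<open>The hyperplane \<open>h y = w\<close> is tangent to the sphere of radius
    \<open>a + \<delta>\<close> about \<open>x0\<close>, at the point in direction
    \<open>u\<close>.\<close>
  define w where "w = a + \<delta> - r"
  define h where "h = (\<lambda>y. (y - p) \<bullet> u)"
  define S where "S = cball x0 b - ball x0 a"
  define H where "H = ball p \<delta> \<inter> {y. 0 \<le> h y}"
  define H1 where "H1 = H \<inter> {y. h y \<le> w}"
  define H2 where "H2 = H \<inter> {y. w < h y}"
  \<comment> \<open>The map \<open>y\<close> to \<open>c - y\<close> reflects in the point at height
    \<open>w / 2\<close> above \<open>p\<close>, so height \<open>t\<close> becomes
    \<open>w - t\<close>. The cap heights between \<open>w\<close> and \<open>\<delta>\<close> go to
    heights between \<open>w - \<delta> = a - r\<close> and 0.\<close>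
  define c where "c = 2 *\<^sub>R p + w *\<^sub>R u"
  define T where "T = (\<lambda>y. c - y) ` H2"
  have w: "0 \<le> w" "w \<le> \<delta>" using r by (auto simp: w_def)
  have uu: "u \<bullet> u = 1" using u by (simp add: dot_square_norm)
  have h_meas [measurable]: "h \<in> borel_measurable borel"
    unfolding h_def by measurable
  have H_borel: "H \<in> sets borel" "H1 \<in> sets borel" "H2 \<in> sets borel"
    unfolding H1_def H2_def H_def by measurable
  have H_bdd: "bounded H" "bounded H1" "bounded H2"
    unfolding H1_def H2_def H_def by (auto intro: bounded_Int)
  have H_lm: "H \<in> lmeasurable" "H1 \<in> lmeasurable" "H2 \<in> lmeasurable"
    using H_borel H_bdd by (auto intro!: bounded_set_imp_lmeasurable)
  have T_lm: "T \<in> lmeasurable"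
    unfolding T_def by (intro lmeasurable_point_reflection H_borel H_bdd)
  have S_lm: "S \<in> lmeasurable"
    unfolding S_def by (intro fmeasurable_Diff) auto
  \<comment> \<open>The inner bound comes from projecting onto \<open>u\<close>. The outer bound
    comes from expanding the square of the norm and using
    \<open>r + w = a + \<delta>\<close>.\<close>
  have in_S: "y \<in> S" if y: "y \<in> ball p \<delta>" "a - r \<le> h y" "h y \<le> w" for y
  proof -
    define z where "z = y - p"
    have z: "norm z < \<delta>" and hz: "h y = z \<bullet> u"
      using y by (auto simp: z_def h_def dist_norm norm_minus_commute)
    have yz: "y - x0 = r *\<^sub>R u + z" by (simp add: z_def p_def)
    have "a \<le> r + z \<bullet> u" using y hz by simp
    also have "\<dots> = (y - x0) \<bullet> u" by (simp add: yz inner_left_distrib uu)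
    also have "\<dots> \<le> norm (y - x0)" using norm_cauchy_schwarz[of "y - x0" u] u by simp
    finally have lo: "a \<le> norm (y - x0)" .
    have "(norm (y - x0))\<^sup>2 = r\<^sup>2 + 2 * r * (z \<bullet> u) + (norm z)\<^sup>2"
      unfolding yz power2_norm_eq_inner
      by (simp add: inner_left_distrib inner_right_distrib uu inner_commute power2_eq_square)
    also have "\<dots> \<le> r\<^sup>2 + 2 * r * w + \<delta>\<^sup>2"
      using z y a r hz by (intro add_mono mult_left_mono power_mono) auto
    also have "\<dots> = (a + \<delta>)\<^sup>2 + \<delta>\<^sup>2 - w\<^sup>2"
      by (simp add: w_def power2_eq_square algebra_simps)
    also have "\<dots> \<le> b\<^sup>2" using b by (smt (verit) zero_le_power2)
    finally have "norm (y - x0) \<le> b" using b(1) power2_le_imp_le by blast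
    with lo show ?thesis by (auto simp: S_def dist_norm norm_minus_commute)
  qed
  have H1_sub: "H1 \<subseteq> ball p \<delta> \<inter> S"
    using in_S r by (auto simp: H1_def H_def)
  have T_sub: "y \<in> ball p \<delta> \<and> a - r \<le> h y \<and> h y < 0" if "y \<in> T" for y
  proof -
    obtain x where x: "x \<in> H2" "y = c - x" using \<open>y \<in> T\<close> by (auto simp: T_def)
    define z where "z = x - p"
    have z: "norm z < \<delta>" "w < z \<bullet> u"
      using x by (auto simp: z_def h_def H2_def H_def dist_norm norm_minus_commute)
    have yz: "y - p = w *\<^sub>R u - z" by (simp add: x c_def z_def algebra_simps scaleR_2)
    have hy: "h y = w - z \<bullet> u" unfolding h_def yz by (simp add: inner_diff_left uu)
    have "z \<bullet> u < \<delta>" using norm_cauchy_schwarz[of z u] u z by simp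
    then have lo: "a - r \<le> h y" by (simp add: hy w_def)
    \<comment> \<open>Cap points lie beyond height \<open>w\<close>, hence are no nearer to
      \<open>p\<close> than their reflections; the reflected cap stays in the ball.\<close>
    have "(norm (y - p))\<^sup>2 = (norm z)\<^sup>2 - w * (2 * (z \<bullet> u) - w)"
      unfolding yz power2_norm_eq_inner
      by (simp add: inner_diff_left inner_diff_right uu inner_commute algebra_simps)
    also have "\<dots> \<le> (norm z)\<^sup>2" using w z by simp
    finally have "norm (y - p) \<le> norm z" using power2_le_imp_le norm_ge_zero by blast
    then have "y \<in> ball p \<delta>" using z by (simp add: dist_norm norm_minus_commute)
    with lo show ?thesis using hy z by simp
  qed
  have T_S: "T \<subseteq> ball p \<delta> \<inter> S"
    using T_sub in_S w by force
  have disj: "H1 \<inter> T = {}"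
    using T_sub by (fastforce simp: H1_def H_def)
  \<comment> \<open>Reflection in the center \<open>p\<close> covers the inward half, so
    \<open>H\<close> carries at least half of the volume.\<close>
  have "ball p \<delta> \<subseteq> H \<union> (\<lambda>y. 2 *\<^sub>R p - y) ` H"
  proof
    fix y assume y: "y \<in> ball p \<delta>"
    show "y \<in> H \<union> (\<lambda>y. 2 *\<^sub>R p - y) ` H"
    proof (cases "0 \<le> h y")
      case False
      have e: "2 *\<^sub>R p - y - p = - (y - p)" by (simp add: scaleR_2)
      have "2 *\<^sub>R p - y \<in> H"
        using y False by (simp add: H_def h_def dist_norm e norm_minus_commute inner_minus_left
            norm_minus_commute[of p "2 *\<^sub>R p - y"] del: minus_diff_eq)
      then show ?thesis by (force intro: image_eqI[of _ _ "2 *\<^sub>R p - y"])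
    qed (use y in \<open>simp add: H_def\<close>)
  qed
  then have "measure lebesgue (ball p \<delta>) \<le> measure lebesgue (H \<union> (\<lambda>y. 2 *\<^sub>R p - y) ` H)"
    by (intro measure_mono_fmeasurable fmeasurable.Un H_lm lmeasurable_point_reflection
        H_borel H_bdd) auto
  also have "\<dots> \<le> measure lebesgue H + measure lebesgue ((\<lambda>y. 2 *\<^sub>R p - y) ` H)"
    by (intro measure_Un_le fmeasurableD H_lm lmeasurable_point_reflection H_borel H_bdd)
  also have "\<dots> = 2 * measure lebesgue H" by (simp add: measure_lebesgue_point_reflection)
  also have "H = H1 \<union> H2" by (auto simp: H1_def H2_def)
  also have "measure lebesgue (H1 \<union> H2) \<le> measure lebesgue H1 + measure lebesgue H2"
    by (intro measure_Un_le fmeasurableD H_lm)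
  also have "measure lebesgue H2 = measure lebesgue T"
    by (simp add: T_def measure_lebesgue_point_reflection)
  also have "measure lebesgue H1 + measure lebesgue T = measure lebesgue (H1 \<union> T)"
    using measure_Un3[OF H_lm(2) T_lm] disj by simp
  also have "\<dots> \<le> measure lebesgue (ball p \<delta> \<inter> S)"
    using H1_sub T_S H_lm T_lm S_lm
    by (intro measure_mono_fmeasurable) (auto intro: fmeasurable.Un)
  finally show ?thesis by (simp add: p_def S_def)
qed

text \<open>The pieces \<open>ball p \<delta> \<inter> S\<close> are disjoint, and each has at least
  half the volume of a ball of radius \<open>\<delta>\<close>. Dividing the volume of
  \<open>S\<close> by that half volume cancels \<open>V\<close> and \<open>\<delta>\<close>.\<close>

lemma card_separated_in_annulus_le:
  fixes F :: "'a::euclidean_space set"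
  assumes fin: "finite F" and sep: "\<And>x y. x \<in> F \<Longrightarrow> y \<in> F \<Longrightarrow> x \<noteq> y \<Longrightarrow> 2 * \<delta> \<le> dist x y"
    and F: "F \<subseteq> annulus x0 \<delta> j" and \<delta>: "\<delta> > 0"
    and R: "0 \<le> R" "(real j + 1)\<^sup>2 + 1 \<le> R\<^sup>2"
  shows "real (card F) \<le> 2 * (R ^ DIM('a) - real j ^ DIM('a))"
proof -
  define V where "V = unit_ball_vol (real DIM('a))"
  define S where "S = cball x0 (R * \<delta>) - ball x0 (real j * \<delta>)"
  have V: "V > 0" by (simp add: V_def)
  have S_lm: "S \<in> lmeasurable"
    unfolding S_def by (intro fmeasurable_Diff) auto
  have jR: "real j \<le> R"
    using R power2_le_imp_le[of "real j" R] by (simp add: power2_eq_square algebra_simps)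
  have half: "V * \<delta> ^ DIM('a) \<le> 2 * measure lebesgue (ball p \<delta> \<inter> S)" if "p \<in> F" for p
  proof -
    \<comment> \<open>If \<open>p = x0\<close>, which can occur when \<open>j = 0\<close>, any unit
      vector serves as the outward direction.\<close>
    obtain u where u: "norm u = 1" "p = x0 + dist p x0 *\<^sub>R u"
    proof (cases "p = x0")
      case True
      with vector_choose_size[of 1] that show ?thesis by auto
    next
      case False
      with that[of "(p - x0) /\<^sub>R norm (p - x0)"] show ?thesis by (simp add: dist_norm)
    qed
    have R\<delta>: "(real j * \<delta> + \<delta>)\<^sup>2 + \<delta>\<^sup>2 \<le> (R * \<delta>)\<^sup>2"
      using mult_right_mono[OF R(2), of "\<delta>\<^sup>2"]
      by (simp add: power2_eq_square algebra_simps)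
    have "real j * \<delta> \<le> dist p x0" "dist p x0 \<le> real j * \<delta> + \<delta>"
      using \<open>p \<in> F\<close> F by (auto simp: annulus_def algebra_simps)
    then have "measure lebesgue (ball p \<delta>) \<le> 2 * measure lebesgue (ball p \<delta> \<inter> S)"
      using half_ball_in_annulus[OF u(1) \<delta> _ _ _ _ R\<delta>, of "dist p x0" x0] u(2) \<delta> R(1)
      by (simp add: S_def)
    then show ?thesis using \<delta> by (simp add: content_ball V_def)
  qed
  have disj: "disjoint_family_on (\<lambda>p. ball p \<delta> \<inter> S) F"
    unfolding disjoint_family_on_def
  proof (intro ballI impI)
    fix p q assume "p \<in> F" "q \<in> F" "p \<noteq> q"
    then have "2 * \<delta> \<le> dist p q" by (rule sep)
    then have "ball p \<delta> \<inter> ball q \<delta> = {}" by (intro disjoint_ballI) simp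
    then show "(ball p \<delta> \<inter> S) \<inter> (ball q \<delta> \<inter> S) = {}" by blast
  qed
  have "real (card F) * (V * \<delta> ^ DIM('a)) = (\<Sum>p\<in>F. V * \<delta> ^ DIM('a))" by simp
  also have "\<dots> \<le> (\<Sum>p\<in>F. 2 * measure lebesgue (ball p \<delta> \<inter> S))"
    by (intro sum_mono half)
  also have "\<dots> = 2 * measure lebesgue (\<Union>p\<in>F. ball p \<delta> \<inter> S)"
  proof -
    have lm: "ball p \<delta> \<inter> S \<in> lmeasurable" for p
      using S_lm lmeasurable_ball by (rule fmeasurable.Int[rotated])
    show ?thesis
      by (subst measure_finite_Union[OF fin _ disj])
        (use lm in \<open>auto simp: sum_distrib_left fmeasurableD dest!: fmeasurableD2 simp del: emeasure_completion\<close>)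
  qed
  also have "\<dots> \<le> 2 * measure lebesgue S"
    using S_lm fin
    by (intro mult_left_mono measure_mono_fmeasurable sets.finite_UN sets.Int fmeasurableD) auto
  also have "measure lebesgue S
      = measure lebesgue (cball x0 (R * \<delta>)) - measure lebesgue (ball x0 (real j * \<delta>))"
    unfolding S_def
  proof (rule measurable_measure_Diff)
    have "real j * \<delta> \<le> R * \<delta>" using jR \<delta> by simp
    then show "ball x0 (real j * \<delta>) \<subseteq> cball x0 (R * \<delta>)"
      using subset_ball ball_subset_cball by blast
  qed auto
  also have "\<dots> = (R ^ DIM('a) - real j ^ DIM('a)) * (V * \<delta> ^ DIM('a))"
    using \<delta> R(1) by (simp add: content_ball content_cball V_def algebra_simps power_mult_distrib)
  finally have "real (card F) * (V * \<delta> ^ DIM('a))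
      \<le> (2 * (R ^ DIM('a) - real j ^ DIM('a))) * (V * \<delta> ^ DIM('a))" by (simp only: mult.assoc)
  then show ?thesis using V \<delta> by (simp only: mult_le_cancel_right) auto
qed

section \<open>Estimating the difference of powers\<close>

lemma power_diff_le_mult:
  fixes x y :: real
  assumes "0 \<le> y" "y \<le> x"
  shows "x ^ n - y ^ n \<le> real n * x ^ (n - 1) * (x - y)"
proof (cases n)
  case (Suc m)
  \<comment> \<open>This sum is the cofactor of \<open>x - y\<close> in the factorization of
    \<open>x ^ n - y ^ n\<close>; each of its \<open>n\<close> terms is at most
    \<open>x ^ m\<close>.\<close>
  have "(\<Sum>p<Suc m. x ^ p * y ^ (m - p)) \<le> (\<Sum>p<Suc m. x ^ m)"
  proof (rule sum_mono)
    fix p assume "p \<in> {..<Suc m}"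
    then have "x ^ p * y ^ (m - p) \<le> x ^ p * x ^ (m - p)" "p + (m - p) = m"
      using assms by (auto intro!: mult_left_mono power_mono)
    then show "x ^ p * y ^ (m - p) \<le> x ^ m" by (metis power_add)
  qed
  then have "(x - y) * (\<Sum>p<Suc m. x ^ p * y ^ (m - p)) \<le> (x - y) * (real n * x ^ m)"
    using assms Suc by (intro mult_left_mono) auto
  then show ?thesis using Suc diff_power_eq_sum[of x m y] by (simp add: mult_ac)
qed simp

text \<open>Each of the \<open>n - 1\<close> factors \<open>R\<close> costs
  \<open>5 / (4 * k - 1)\<close> in the exponent and the factor \<open>R - k\<close> costs
  \<open>2 / (4 * k - 1)\<close>; the numerators add up to \<open>5 * n - 3\<close>.\<close>

lemma annulus_volume_le_exp:
  fixes R :: real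
  assumes j: "j \<ge> 1" and R: "R = sqrt ((real j + 1)\<^sup>2 + 1)" and n: "n \<ge> 1"
  shows "R ^ n - real j ^ n
    \<le> real n * real j ^ (n - 1) * exp ((5 * real n - 3) / (4 * real j - 1))"
proof -
  define k where "k = real j"
  have k: "k \<ge> 1" using j by (simp add: k_def)
  \<comment> \<open>Completing the square: the cross term of the right-hand square is exactly
    1.\<close>
  have "R \<le> sqrt ((k + 1 + 1 / (2 * (k + 1)))\<^sup>2)"
    unfolding R k_def[symmetric] using k
    by (intro real_sqrt_le_mono) (simp add: power2_sum)
  then have R_le: "R - k \<le> 1 + 1 / (2 * (k + 1))" using k by simp
  have kR: "k \<le> R" unfolding R k_def[symmetric]
    by (rule real_le_rsqrt) (use k in \<open>simp add: power2_eq_square algebra_simps\<close>)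
  have "1 / (2 * (k + 1)) \<le> 2 / (4 * k - 1)"
    using k by (simp add: divide_simps)
  then have e1: "R - k \<le> exp (2 / (4 * k - 1))"
    using R_le exp_ge_add_one_self[of "2 / (4 * k - 1)"] by linarith
  \<comment> \<open>The next inequality with denominators cleared; the two sides differ by
    \<open>2 * k\<^sup>2 + 3\<close>.\<close>
  have "(2 * k + 3) * (4 * k - 1) \<le> 5 * k * (2 * (k + 1))"
    using k by (simp add: algebra_simps)
  then have "1 + 1 / (2 * (k + 1)) \<le> k * (5 / (4 * k - 1))"
    using k by (simp add: divide_simps) (simp add: algebra_simps)
  then have "R \<le> k * (1 + 5 / (4 * k - 1))" using R_le by (simp add: algebra_simps)
  also have "\<dots> \<le> k * exp (5 / (4 * k - 1))"
    using k by (intro mult_left_mono exp_ge_add_one_self) auto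
  finally have e2: "R \<le> k * exp (5 / (4 * k - 1))" .
  have "R ^ n - k ^ n \<le> real n * R ^ (n - 1) * (R - k)"
    using k kR by (intro power_diff_le_mult) auto
  also have "\<dots> \<le> real n * (k * exp (5 / (4 * k - 1))) ^ (n - 1) * exp (2 / (4 * k - 1))"
    using k kR e1 e2 by (intro mult_mono mult_left_mono power_mono) auto
  also have "\<dots> = real n * k ^ (n - 1)
      * (exp (real (n - 1) * (5 / (4 * k - 1))) * exp (2 / (4 * k - 1)))"
    by (simp only: power_mult_distrib exp_of_nat_mult mult.assoc)
  also have "exp (real (n - 1) * (5 / (4 * k - 1))) * exp (2 / (4 * k - 1))
      = exp ((5 * real n - 3) / (4 * k - 1))"
    using n by (simp add: exp_add[symmetric] of_nat_diff add_divide_distrib[symmetric] algebra_simps)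
  finally show ?thesis by (simp add: k_def)
qed

section \<open>From the separation radius to the count\<close>

lemma separation_radius_le_dist:
  assumes "separation_radius X = ereal \<delta>" "x \<in> X" "y \<in> X" "x \<noteq> y"
  shows "2 * \<delta> \<le> dist x y"
proof -
  have "(INF (x, y) \<in> {(x, y). x \<in> X \<and> y \<in> X \<and> x \<noteq> y}. ereal (dist x y)) \<le> ereal (dist x y)"
    using assms(2-4) by (intro INF_lower2[of "(x, y)"]) auto
  then have "separation_radius X \<le> (1 / 2) * ereal (dist x y)"
    unfolding separation_radius_def by (intro ereal_mult_left_mono) auto
  also have "\<dots> = ereal (dist x y / 2)"
    by (simp add: one_ereal_def numeral_eq_ereal)
  finally show ?thesis using assms(1) by simp
qed

text \<open>Finiteness is claimed separately because \<open>card\<close> of an infinite set is 0,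
  which would make the bound alone uninformative.\<close>

theorem corollary2p3:
  fixes X :: "(real ^ 'n) set" and x0 :: "real ^ 'n" and \<delta> :: real and j :: nat
  assumes "discrete X"
    and "separation_radius X = ereal \<delta>"
    and "\<delta> > 0"
    and "j \<ge> 1"
  shows "finite (X \<inter> annulus x0 \<delta> j) \<and>
    real (card (X \<inter> annulus x0 \<delta> j))
      \<le> 2 * real CARD('n) * real j ^ (CARD('n) - 1)
          * exp ((5 * real CARD('n) - 3) / (4 * real j - 1))"
proof -
  define R where "R = sqrt ((real j + 1)\<^sup>2 + 1)"
  define B where "B = 2 * real CARD('n) * real j ^ (CARD('n) - 1)
          * exp ((5 * real CARD('n) - 3) / (4 * real j - 1))"
  \<comment> \<open>Volume comparison applies to finite subsets first; as \<open>B\<close> does not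
    depend on \<open>F\<close>, finiteness of the whole intersection follows, and then the bound for
    it.\<close>
  have bound: "real (card F) \<le> B" if "finite F" "F \<subseteq> X \<inter> annulus x0 \<delta> j" for F
  proof -
    have "real (card F) \<le> 2 * (R ^ CARD('n) - real j ^ CARD('n))"
      using card_separated_in_annulus_le[of F \<delta> x0 j R] that assms(3)
        separation_radius_le_dist[OF assms(2)]
      by (auto simp: R_def)
    also have "\<dots> \<le> B"
      using annulus_volume_le_exp[OF assms(4) R_def, of "CARD('n)"] by (simp add: B_def)
    finally show ?thesis .
  qed
  have "card F \<le> nat \<lfloor>B\<rfloor>" if "F \<subseteq> X \<inter> annulus x0 \<delta> j" "finite F" for F
    using bound[OF that(2,1)] by (simp add: le_nat_floor)
  then have "finite (X \<inter> annulus x0 \<delta> j)"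
    using finite_if_finite_subsets_card_bdd by blast
  with bound[of "X \<inter> annulus x0 \<delta> j"] show ?thesis by (simp add: B_def)
qed

end
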